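(* As formal power series in $z$, $$F(312;q,z)=\frac{1}{1-zF(231;q,z)}.$$
   Context: $S_n$ is the set of permutations of $[n]=\{1,\ldots,n\}$ (with $S_0$ consisting of the empty permutation, which has no crossing). For a pattern $\tau\in S_m$, $S_n(\tau)$ is the set of $\sigma\in S_n$ avoiding $\tau$, i.e. having no subsequence $\sigma(i_1)\cdots\sigma(i_m)$ with $i_1<\cdots<i_m$ in the same relative order as $\tau$. A crossing of $\sigma$ is a pair $(i,j)$ with $i<j<\sigma(i)<\sigma(j)$ or $\sigma(i)<\sigma(j)\leq i<j$; $\mathrm{cr}(\sigma)$ is the number of crossings. For a pattern $\tau$, $$F(\tau;q,z)=\sum_{n\geq 0}\Big(\sum_{\sigma\in S_n(\tau)}q^{\mathrm{cr}(\sigma)}\Big)z^n.$$ *)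

theory Defs
  imports
    "HOL-Combinatorics.Permutations"
    "HOL-Computational_Algebra.Computational_Algebra"
begin

definition perms :: "nat \<Rightarrow> (nat \<Rightarrow> nat) set" where
  "perms n = {\<sigma>. \<sigma> permutes {1..n}}"

text \<open>A pattern is given by its one-line word, so that 312 is \<open>[3, 1, 2]\<close>.
  The subsequence positions are \<open>s 0 < s 1 < \<dots>\<close>.\<close>

definition contains_pattern :: "nat \<Rightarrow> (nat \<Rightarrow> nat) \<Rightarrow> nat list \<Rightarrow> bool" where
  "contains_pattern n \<sigma> \<tau> \<longleftrightarrow>
    (\<exists>s. strict_mono_on {..<length \<tau>} s \<and> s ` {..<length \<tau>} \<subseteq> {1..n} \<and>
      (\<forall>a<length \<tau>. \<forall>b<length \<tau>. \<sigma> (s a) < \<sigma> (s b) \<longleftrightarrow> \<tau> ! a < \<tau> ! b))"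

definition avoiders :: "nat \<Rightarrow> nat list \<Rightarrow> (nat \<Rightarrow> nat) set" where
  "avoiders n \<tau> = {\<sigma> \<in> perms n. \<not> contains_pattern n \<sigma> \<tau>}"

definition crossings :: "nat \<Rightarrow> (nat \<Rightarrow> nat) \<Rightarrow> (nat \<times> nat) set" where
  "crossings n \<sigma> = {(i, j). i \<in> {1..n} \<and> j \<in> {1..n} \<and>
    (i < j \<and> j < \<sigma> i \<and> \<sigma> i < \<sigma> j \<or> \<sigma> i < \<sigma> j \<and> \<sigma> j \<le> i \<and> i < j)}"

definition cr :: "nat \<Rightarrow> (nat \<Rightarrow> nat) \<Rightarrow> nat" where
  "cr n \<sigma> = card (crossings n \<sigma>)"

definition crossing_poly :: "nat list \<Rightarrow> nat \<Rightarrow> int poly" where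
  "crossing_poly \<tau> n = (\<Sum>\<sigma>\<in>avoiders n \<tau>. [:0, 1:] ^ cr n \<sigma>)"

text \<open>The indeterminate \<open>q\<close> is \<open>[:0, 1:]\<close> and \<open>z\<close> is \<^const>\<open>fps_X\<close>. The coefficients are
  integer polynomials in \<open>q\<close>, embedded in their fraction field because division of
  formal power series is only available over coefficient types with an inverse.\<close>

definition F :: "nat list \<Rightarrow> int poly fract fps" where
  "F \<tau> = Abs_fps (\<lambda>n. to_fract (crossing_poly \<tau> n))"

end

theory Submission
  imports Defs
begin

text \<open>A nonempty 312-avoiding permutation with value 1 at position \<open>k + 1\<close> is a direct sum
  \<open>\<alpha>' \<oplus> \<tau>\<close>, where \<open>\<tau>\<close> avoids 312 and the word of \<open>\<alpha>'\<close> is that of a 312-avoiding \<open>\<alpha> \<in> S\<^sub>k\<close>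
  with all values raised by one, followed by 1. Crossings are additive over direct sums.
  Raising the values turns the two kinds of crossings of \<open>\<alpha>'\<close> into
  \<open>i < j \<le> \<alpha> i < \<alpha> j\<close> and \<open>\<alpha> i < \<alpha> j < i < j\<close>: exchanging positions with values, these are
  the crossings of the inverse \<open>\<rho>\<close> of \<open>\<alpha>\<close>, which avoids 231.
  Hence \<open>F(312) = 1 + z F(231) F(312)\<close>.\<close>

section \<open>Three-letter patterns and inverses\<close>

lemma contains_pattern_3:
  "contains_pattern n \<sigma> [x, y, z] \<longleftrightarrow>
    (\<exists>a b c. 1 \<le> a \<and> a < b \<and> b < c \<and> c \<le> n \<and>
      (\<sigma> a < \<sigma> b \<longleftrightarrow> x < y) \<and> (\<sigma> a < \<sigma> c \<longleftrightarrow> x < z) \<and> (\<sigma> b < \<sigma> c \<longleftrightarrow> y < z) \<and>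
      (\<sigma> b < \<sigma> a \<longleftrightarrow> y < x) \<and> (\<sigma> c < \<sigma> a \<longleftrightarrow> z < x) \<and> (\<sigma> c < \<sigma> b \<longleftrightarrow> z < y))"
    (is "_ \<longleftrightarrow> ?R")
proof
  assume "contains_pattern n \<sigma> [x, y, z]"
  then obtain s where mono: "strict_mono_on {..<3} s" and sub: "s ` {..<3} \<subseteq> {1..n}"
    and s: "\<And>a b. a < 3 \<Longrightarrow> b < 3 \<Longrightarrow> \<sigma> (s a) < \<sigma> (s b) \<longleftrightarrow> [x, y, z] ! a < [x, y, z] ! b"
    by (auto simp: contains_pattern_def numeral_3_eq_3)
  have "s 0 < s 1" "s 1 < s 2" "1 \<le> s 0" "s 2 \<le> n"
    using strict_mono_onD[OF mono, of 0 1] strict_mono_onD[OF mono, of 1 2]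
      subsetD[OF sub imageI, of 0] subsetD[OF sub imageI, of 2] by simp_all
  then show ?R
    using s[of 0 1] s[of 0 2] s[of 1 2] s[of 1 0] s[of 2 0] s[of 2 1]
    by (intro exI[of _ "s 0"] exI[of _ "s 1"] exI[of _ "s 2"]) simp
next
  assume ?R
  then obtain a b c where abc: "1 \<le> a" "a < b" "b < c" "c \<le> n"
    "\<sigma> a < \<sigma> b \<longleftrightarrow> x < y" "\<sigma> a < \<sigma> c \<longleftrightarrow> x < z" "\<sigma> b < \<sigma> c \<longleftrightarrow> y < z"
    "\<sigma> b < \<sigma> a \<longleftrightarrow> y < x" "\<sigma> c < \<sigma> a \<longleftrightarrow> z < x" "\<sigma> c < \<sigma> b \<longleftrightarrow> z < y" by blast
  have all: "(\<forall>i<length [x, y, z]. P i) \<longleftrightarrow> P 0 \<and> P 1 \<and> P 2" for P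
    by (auto simp: All_less_Suc numeral_2_eq_2)
  have sets: "{..<length [x, y, z]} = {0, 1, 2}" by auto
  have "strict_mono_on {0, 1, 2} ((!) [a, b, c])"
    using abc(2,3) by (auto simp: strict_mono_on_def)
  then show "contains_pattern n \<sigma> [x, y, z]"
    unfolding contains_pattern_def sets all using abc
    by (intro exI[of _ "(!) [a, b, c]"]) simp
qed

text \<open>Two of the six comparisons suffice: transitivity and asymmetry give the others.\<close>

lemma contains_312_iff:
  "contains_pattern n \<sigma> [3, 1, 2] \<longleftrightarrow>
    (\<exists>a b c. 1 \<le> a \<and> a < b \<and> b < c \<and> c \<le> n \<and> \<sigma> b < \<sigma> c \<and> \<sigma> c < \<sigma> a)"
  unfolding contains_pattern_3 by (auto, fastforce)

lemma contains_231_iff: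
  "contains_pattern n \<sigma> [2, 3, 1] \<longleftrightarrow>
    (\<exists>a b c. 1 \<le> a \<and> a < b \<and> b < c \<and> c \<le> n \<and> \<sigma> c < \<sigma> a \<and> \<sigma> a < \<sigma> b)"
  unfolding contains_pattern_3 by (auto, fastforce)

lemma permutes_in_Icc1:
  fixes n :: nat
  assumes "\<rho> permutes {1..n}" "1 \<le> i" "i \<le> n"
  shows "1 \<le> \<rho> i" "\<rho> i \<le> n"
  using permutes_in_image[OF assms(1), of i] assms(2,3) by auto

text \<open>Inversion exchanges positions and values, and 231 is the inverse of 312. If
  \<open>inv \<rho>\<close> has a 312 at positions a < b < c, then \<rho> takes the values b, c, a
  at the increasing positions \<open>inv \<rho> b\<close>, \<open>inv \<rho> c\<close>,
  \<open>inv \<rho> a\<close>, which is a 231; the converse is symmetric.\<close>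

lemma contains_312_inv:
  assumes "\<rho> permutes {1..n}"
  shows "contains_pattern n (inv \<rho>) [3, 1, 2] \<longleftrightarrow> contains_pattern n \<rho> [2, 3, 1]"
proof
  note p = permutes_in_Icc1[OF assms] and q = permutes_in_Icc1[OF permutes_inv[OF assms]]
  {
    assume "contains_pattern n (inv \<rho>) [3, 1, 2]"
    then obtain a b c where "1 \<le> a" "a < b" "b < c" "c \<le> n" "inv \<rho> b < inv \<rho> c" "inv \<rho> c < inv \<rho> a"
      unfolding contains_312_iff by blast
    then show "contains_pattern n \<rho> [2, 3, 1]"
      unfolding contains_231_iff using q[of a] q[of b]
      by (intro exI[of _ "inv \<rho> b"] exI[of _ "inv \<rho> c"] exI[of _ "inv \<rho> a"])
        (auto simp: permutes_inverses[OF assms])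
  next
    assume "contains_pattern n \<rho> [2, 3, 1]"
    then obtain a b c where "1 \<le> a" "a < b" "b < c" "c \<le> n" "\<rho> c < \<rho> a" "\<rho> a < \<rho> b"
      unfolding contains_231_iff by blast
    then show "contains_pattern n (inv \<rho>) [3, 1, 2]"
      unfolding contains_312_iff using p[of b] p[of c]
      by (intro exI[of _ "\<rho> b"] exI[of _ "\<rho> c"] exI[of _ "\<rho> a"])
        (auto simp: permutes_inverses[OF assms])
  }
qed

section \<open>The gluing map and its effect on patterns and crossings\<close>

lemma finite_crossings: "finite (crossings n \<sigma>)"
  by (rule finite_subset[of _ "{1..n} \<times> {1..n}"]) (auto simp: crossings_def)

text \<open>The direct sum \<alpha>' \<oplus> \<tau> of the overview, parametrized by the inverse
  \<rho> of \<alpha> so that the first factor is the 231-avoider. The case \<open>i = 0\<close> is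
  separate because a permutation of {1..n} must fix 0, whereas \<open>Suc (inv \<rho> 0)\<close> is
  1. The length of \<tau> does not enter: the last branch fixes every later position because \<tau>
  fixes everything beyond its length.\<close>

definition glue :: "nat \<Rightarrow> (nat \<Rightarrow> nat) \<Rightarrow> (nat \<Rightarrow> nat) \<Rightarrow> nat \<Rightarrow> nat" where
  "glue k \<rho> \<tau> i = (if i = 0 then 0 else if i \<le> k then Suc (inv \<rho> i)
    else if i = Suc k then 1 else \<tau> (i - Suc k) + Suc k)"

lemma glue_low: "1 \<le> i \<Longrightarrow> i \<le> k \<Longrightarrow> glue k \<rho> \<tau> i = Suc (inv \<rho> i)"
  by (simp add: glue_def)

lemma glue_mid: "glue k \<rho> \<tau> (Suc k) = 1"
  by (simp add: glue_def)

lemma glue_high: "1 \<le> i \<Longrightarrow> glue k \<rho> \<tau> (i + Suc k) = \<tau> i + Suc k"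
  by (simp add: glue_def)

context
  fixes k m :: nat and \<rho> \<tau> :: "nat \<Rightarrow> nat"
  assumes \<rho>: "\<rho> permutes {1..k}" and \<tau>: "\<tau> permutes {1..m}"
begin

lemma glue_low_bounds:
  assumes "1 \<le> i" "i \<le> k"
  shows "2 \<le> glue k \<rho> \<tau> i" "glue k \<rho> \<tau> i \<le> Suc k"
  using permutes_in_Icc1[OF permutes_inv[OF \<rho>] assms] glue_low[OF assms] by auto

lemma glue_high_bounds:
  assumes "Suc k < i" "i \<le> k + Suc m"
  shows "Suc k < glue k \<rho> \<tau> i" "glue k \<rho> \<tau> i \<le> k + Suc m"
proof -
  have "1 \<le> i - Suc k" "i - Suc k \<le> m" using assms by auto
  from permutes_in_Icc1[OF \<tau> this] assms
  show "Suc k < glue k \<rho> \<tau> i" "glue k \<rho> \<tau> i \<le> k + Suc m"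
    by (auto simp: glue_def)
qed

text \<open>Positions up to k, position k + 1 and later positions take values in the disjoint sets
  {2..k+1}, {1} and {k+2..k+m+1}. Within the first and the last, injectivity is that of
  \<open>inv \<rho>\<close> and \<tau>.\<close>

lemma inj_glue: "inj_on (glue k \<rho> \<tau>) {1..k + Suc m}"
proof (rule linorder_inj_onI')
  fix i j assume "i \<in> {1..k + Suc m}" "j \<in> {1..k + Suc m}" and "i < j"
  then consider "1 \<le> i" "i \<le> k" "j \<le> k" | "1 \<le> i" "i \<le> k" "j = Suc k"
    | "1 \<le> i" "i \<le> Suc k" "Suc k < j" "j \<le> k + Suc m" | "Suc k < i" by force
  then show "glue k \<rho> \<tau> i \<noteq> glue k \<rho> \<tau> j"
  proof cases
    case 1
    then show ?thesis
      using \<open>i < j\<close> injD[OF permutes_inj[OF permutes_inv[OF \<rho>]], of i j] by (auto simp: glue_low)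
  next
    case 2
    then show ?thesis using glue_low_bounds(1)[of i] glue_mid by simp
  next
    case 3
    then have "glue k \<rho> \<tau> i \<le> Suc k"
      using glue_low_bounds(2)[of i] glue_mid by (cases "i = Suc k") simp_all
    then show ?thesis using 3 glue_high_bounds(1)[of j] by simp
  next
    case 4
    then show ?thesis
      using \<open>i < j\<close> injD[OF permutes_inj[OF \<tau>], of "i - Suc k" "j - Suc k"]
      by (auto simp: glue_def)
  qed
qed

lemma glue_permutes: "glue k \<rho> \<tau> permutes {1..k + Suc m}"
proof (rule bij_imp_permutes)
  have "glue k \<rho> \<tau> ` {1..k + Suc m} \<subseteq> {1..k + Suc m}"
  proof (intro image_subsetI)
    fix i assume "i \<in> {1..k + Suc m}"
    then consider "1 \<le> i" "i \<le> k" | "i = Suc k" | "Suc k < i" "i \<le> k + Suc m" by force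
    then show "glue k \<rho> \<tau> i \<in> {1..k + Suc m}"
    proof cases
      case 1
      then show ?thesis using glue_low_bounds[of i] by simp
    next
      case 2
      then show ?thesis using glue_mid by simp
    next
      case 3
      then show ?thesis using glue_high_bounds[of i] by simp
    qed
  qed
  then show "bij_betw (glue k \<rho> \<tau>) {1..k + Suc m} {1..k + Suc m}"
    using inj_glue by (simp add: bij_betw_def endo_inj_surj)
next
  fix i assume "i \<notin> {1..k + Suc m}"
  then consider "i = 0" | "k + Suc m < i" by force
  then show "glue k \<rho> \<tau> i = i"
  proof cases
    case 2
    \<comment> \<open>Here \<open>i - Suc k\<close> exceeds m, so \<tau> fixes it and adding
      \<open>Suc k\<close> back returns i.\<close>
    then have "\<tau> (i - Suc k) = i - Suc k" by (intro permutes_not_in[OF \<tau>]) auto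
    with 2 show ?thesis by (simp add: glue_def)
  qed (simp add: glue_def)
qed

text \<open>Every value after position k + 1 exceeds every value up to it. So an occurrence of 312
  cannot have its 3 on the left and its 2 on the right, and must lie on one side.\<close>

lemma contains_312_glue_iff:
  "contains_pattern (k + Suc m) (glue k \<rho> \<tau>) [3, 1, 2] \<longleftrightarrow>
    contains_pattern k \<rho> [2, 3, 1] \<or> contains_pattern m \<tau> [3, 1, 2]"
  unfolding contains_312_inv[OF \<rho>, symmetric]
proof
  assume "contains_pattern (k + Suc m) (glue k \<rho> \<tau>) [3, 1, 2]"
  then obtain a b c where abc: "1 \<le> a" "a < b" "b < c" "c \<le> k + Suc m"
    "glue k \<rho> \<tau> b < glue k \<rho> \<tau> c" "glue k \<rho> \<tau> c < glue k \<rho> \<tau> a"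
    unfolding contains_312_iff by blast
  consider "c \<le> Suc k" | "Suc k < c" "a \<le> Suc k" | "Suc k < a" by linarith
  then show "contains_pattern k (inv \<rho>) [3, 1, 2] \<or> contains_pattern m \<tau> [3, 1, 2]"
  proof cases
    case 1
    with abc have "c \<noteq> Suc k" using glue_mid glue_low_bounds[of b] by auto
    with 1 abc have "contains_pattern k (inv \<rho>) [3, 1, 2]"
      unfolding contains_312_iff
      by (intro exI[of _ a] exI[of _ b] exI[of _ c]) (auto simp: glue_low)
    then show ?thesis ..
  next
    case 2
    then have "Suc k < glue k \<rho> \<tau> c" using glue_high_bounds[of c] abc by auto
    moreover have "glue k \<rho> \<tau> a \<le> Suc k"
      using 2 abc glue_low_bounds[of a] glue_mid by (cases "a = Suc k") auto
    ultimately show ?thesis using abc by auto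
  next
    case 3
    with abc have "contains_pattern m \<tau> [3, 1, 2]"
      unfolding contains_312_iff
      by (intro exI[of _ "a - Suc k"] exI[of _ "b - Suc k"] exI[of _ "c - Suc k"])
        (auto simp: glue_def)
    then show ?thesis ..
  qed
next
  assume "contains_pattern k (inv \<rho>) [3, 1, 2] \<or> contains_pattern m \<tau> [3, 1, 2]"
  then show "contains_pattern (k + Suc m) (glue k \<rho> \<tau>) [3, 1, 2]"
  proof
    assume "contains_pattern k (inv \<rho>) [3, 1, 2]"
    then obtain a b c where "1 \<le> a" "a < b" "b < c" "c \<le> k" "inv \<rho> b < inv \<rho> c" "inv \<rho> c < inv \<rho> a"
      unfolding contains_312_iff by blast
    then show ?thesis unfolding contains_312_iff
      by (intro exI[of _ a] exI[of _ b] exI[of _ c]) (auto simp: glue_low)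
  next
    assume "contains_pattern m \<tau> [3, 1, 2]"
    then obtain a b c where "1 \<le> a" "a < b" "b < c" "c \<le> m" "\<tau> b < \<tau> c" "\<tau> c < \<tau> a"
      unfolding contains_312_iff by blast
    then show ?thesis unfolding contains_312_iff
      by (intro exI[of _ "a + Suc k"] exI[of _ "b + Suc k"] exI[of _ "c + Suc k"])
        (auto simp: glue_high simp del: add_Suc_right)
  qed
qed

text \<open>No other pair crosses. For j = k + 1 the value 1 is too small to exceed
  \<open>glue k \<rho> \<tau> i\<close>. For i \<le> k + 1 < j the value at i is at most k + 1 < j,
  and the value at j exceeds k + 1 \<ge> i, which excludes both kinds of crossing.\<close>

lemma crossings_glue:
  "crossings (k + Suc m) (glue k \<rho> \<tau>) =
    (\<lambda>(a, b). (\<rho> a, \<rho> b)) ` crossings k \<rho> \<union> (\<lambda>(a, b). (a + Suc k, b + Suc k)) ` crossings m \<tau>"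
    (is "?L = ?A \<union> ?B")
proof (intro equalityI subrelI)
  fix i j assume ij: "(i, j) \<in> ?L"
  then have i: "1 \<le> i" "i \<le> k + Suc m" and j: "1 \<le> j" "j \<le> k + Suc m" and lt: "i < j"
    and d: "j < glue k \<rho> \<tau> i \<and> glue k \<rho> \<tau> i < glue k \<rho> \<tau> j \<or>
      glue k \<rho> \<tau> i < glue k \<rho> \<tau> j \<and> glue k \<rho> \<tau> j \<le> i"
    unfolding crossings_def by auto
  consider "j \<le> k" | "j = Suc k" | "i \<le> Suc k" "Suc k < j" | "Suc k < i" by linarith
  then show "(i, j) \<in> ?A \<union> ?B"
  proof cases
    case 1
    with i j lt have "1 \<le> inv \<rho> i" "inv \<rho> i \<le> k" "1 \<le> inv \<rho> j" "inv \<rho> j \<le> k"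
      using permutes_in_Icc1[OF permutes_inv[OF \<rho>]] by auto
    \<comment> \<open>The two kinds are swapped: with a = \<open>inv \<rho> i\<close> and b =
      \<open>inv \<rho> j\<close>, the condition j < a + 1 < b + 1 reads \<rho> a < \<rho> b \<le> a
      < b, and a + 1 < b + 1 \<le> i reads a < b < \<rho> a < \<rho> b.\<close>
    then have "(inv \<rho> i, inv \<rho> j) \<in> crossings k \<rho>"
      using 1 i j lt d by (auto simp: crossings_def glue_low permutes_inverses[OF \<rho>])
    then have "(\<lambda>(a, b). (\<rho> a, \<rho> b)) (inv \<rho> i, inv \<rho> j) \<in> ?A" by (rule imageI)
    then show ?thesis by (simp add: permutes_inverses[OF \<rho>])
  next
    case 2
    then show ?thesis using d glue_mid glue_low_bounds[of i] i lt by auto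
  next
    case 3
    have "glue k \<rho> \<tau> i \<le> Suc k"
      using 3 i glue_low_bounds[of i] glue_mid by (cases "i = Suc k") auto
    moreover have "Suc k < glue k \<rho> \<tau> j"
      using 3 j glue_high_bounds(1)[of j] by simp
    ultimately show ?thesis using 3 d by linarith
  next
    case 4
    then have "(i - Suc k, j - Suc k) \<in> crossings m \<tau>"
      using i j lt d by (auto simp: crossings_def glue_def)
    then have "(\<lambda>(a, b). (a + Suc k, b + Suc k)) (i - Suc k, j - Suc k) \<in> ?B" by (rule imageI)
    then show ?thesis using 4 lt by simp
  qed
next
  fix i j assume "(i, j) \<in> ?A \<union> ?B"
  then show "(i, j) \<in> ?L"
  proof
    assume "(i, j) \<in> ?A"
    then obtain a b where ab: "(a, b) \<in> crossings k \<rho>" "i = \<rho> a" "j = \<rho> b" by auto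
    then have "1 \<le> i" "i \<le> k" "1 \<le> j" "j \<le> k"
      using permutes_in_Icc1[OF \<rho>] by (auto simp: crossings_def)
    then show ?thesis
      using ab by (auto simp: crossings_def glue_low permutes_inverses[OF \<rho>])
  next
    assume "(i, j) \<in> ?B"
    then show ?thesis
      by (auto simp: crossings_def glue_high simp del: add_Suc_right)
  qed
qed

lemma cr_glue: "cr (k + Suc m) (glue k \<rho> \<tau>) = cr k \<rho> + cr m \<tau>"
proof -
  \<comment> \<open>First components are at most k in one set and greater than k + 1 in the
    other.\<close>
  have "(\<lambda>(a, b). (\<rho> a, \<rho> b)) ` crossings k \<rho> \<inter> (\<lambda>(a, b). (a + Suc k, b + Suc k)) ` crossings m \<tau> = {}"
    using permutes_in_Icc1(2)[OF \<rho>] by (fastforce simp: crossings_def)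
  moreover have "inj_on (\<lambda>(a, b). (\<rho> a, \<rho> b)) (crossings k \<rho>)"
    using injD[OF permutes_inj[OF \<rho>]] by (auto intro!: inj_onI)
  moreover have "inj_on (\<lambda>(a, b). (a + Suc k, b + Suc k)) (crossings m \<tau>)"
    by (auto intro!: inj_onI)
  ultimately show ?thesis
    unfolding cr_def crossings_glue
    by (subst card_Un_disjoint) (auto simp: finite_crossings card_image)
qed

end

section \<open>Unique decomposition of nonempty 312-avoiders\<close>

lemma glue_eq_imp_eq:
  assumes \<rho>: "\<rho> permutes {1..k}" and \<tau>: "\<tau> permutes {1..m}"
    and \<rho>': "\<rho>' permutes {1..k'}" and \<tau>': "\<tau>' permutes {1..m'}"
    and sum: "k + m = k' + m'" and eq: "glue k \<rho> \<tau> = glue k' \<rho>' \<tau>'"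
  shows "k = k' \<and> \<rho> = \<rho>' \<and> \<tau> = \<tau>'"
proof -
  \<comment> \<open>The position of the value 1 determines k. The equation \<open>sum\<close> keeps
    \<open>Suc k'\<close> inside the interval on which \<open>glue k \<rho> \<tau>\<close> is known
    to be injective.\<close>
  have "glue k \<rho> \<tau> (Suc k) = glue k \<rho> \<tau> (Suc k')"
    using eq glue_mid[of k \<rho> \<tau>] glue_mid[of k' \<rho>' \<tau>'] by metis
  then have k: "k' = k"
    using inj_onD[OF inj_glue[OF \<rho> \<tau>]] sum by fastforce
  have "inv \<rho> i = inv \<rho>' i" for i
  proof (cases "i \<in> {1..k}")
    case True
    then show ?thesis using fun_cong[OF eq, of i] by (simp add: glue_def k)
  next
    case False
    then show ?thesis
      using permutes_not_in[OF permutes_inv[OF \<rho>], of i]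
        permutes_not_in[OF permutes_inv[OF \<rho>'], of i] k by simp
  qed
  then have "inv \<rho> = inv \<rho>'" by (rule ext)
  then have "\<rho> = \<rho>'" using permutes_inv_inv[OF \<rho>] permutes_inv_inv[OF \<rho>'] by metis
  \<comment> \<open>Only i \<ge> 1 can be read off at position i + k + 1, since position k + 1
    itself holds the value 1; both permutations fix 0.\<close>
  moreover have "\<tau> i = \<tau>' i" for i
  proof (cases "i = 0")
    case True
    then show ?thesis using permutes_not_in[OF \<tau>, of 0] permutes_not_in[OF \<tau>', of 0] by simp
  next
    case False
    then show ?thesis using fun_cong[OF eq, of "i + Suc k"] by (simp add: glue_def k)
  qed
  ultimately show ?thesis using k by blast
qed

text \<open>With \<open>\<sigma> c = 1\<close>, avoiding 312 forces every value before position \<open>c\<close> below every value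
  after it, so positions \<open>{1..c}\<close> form a block.\<close>

lemma avoiding_312_block:
  assumes \<sigma>: "\<sigma> permutes {1..n}" and av: "\<not> contains_pattern n \<sigma> [3, 1, 2]"
    and c: "1 \<le> c" "c \<le> n" "\<sigma> c = 1"
  shows "\<sigma> ` {1..c} = {1..c}"
proof -
  note s = permutes_in_Icc1[OF \<sigma>] and inj = permutes_inj[OF \<sigma>]
  have less: "\<sigma> i < \<sigma> j" if "1 \<le> i" "i \<le> c" "c < j" "j \<le> n" for i j
  proof (rule ccontr)
    assume "\<not> \<sigma> i < \<sigma> j"
    then have "\<sigma> j < \<sigma> i" using injD[OF inj, of i j] that by force
    moreover have "\<sigma> c < \<sigma> j" using s[of j] c injD[OF inj, of c j] that by force
    \<comment> \<open>Since \<sigma> c < \<sigma> j < \<sigma> i, the positions i and c differ, and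
      i < c < j is an occurrence of 312.\<close>
    ultimately have "i < c" using that(2) by (cases "i = c") auto
    with \<open>\<sigma> c < \<sigma> j\<close> \<open>\<sigma> j < \<sigma> i\<close> that av show False unfolding contains_312_iff by blast
  qed
  have "\<sigma> i \<le> c" if i: "1 \<le> i" "i \<le> c" for i
  proof (rule ccontr)
    assume "\<not> \<sigma> i \<le> c"
    \<comment> \<open>Counting: the n - c positions after c all have values above \<sigma> i, so
      there must be room for n - c values there, which forces \<sigma> i \<le> c.\<close>
    moreover have "\<sigma> ` {c<..n} \<subseteq> {\<sigma> i<..n}"
      using less[OF i] s(2) c by fastforce
    then have "card {c<..n} \<le> card {\<sigma> i<..n}"
      by (rule card_inj_on_le[OF inj_on_subset[OF inj], rotated]) auto
    ultimately show False using s(2)[of i] i c by auto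
  qed
  then have "\<sigma> ` {1..c} \<subseteq> {1..c}" using s(1) c by fastforce
  then show ?thesis by (intro endo_inj_surj inj_on_subset[OF inj]) auto
qed

text \<open>Cut \<sigma> after the position c = k + 1 of the value 1. Both sides of the cut are
  preserved by \<sigma>; lowering the first k letters by 1 gives \<alpha>, and lowering the letters
  after c by k + 1 gives \<tau>. The witness for \<rho> is \<open>inv \<alpha>\<close>, because
  \<open>glue\<close> inverts that argument again.\<close>

lemma avoiding_312_eq_glue:
  assumes \<sigma>: "\<sigma> permutes {1..Suc n}" and av: "\<not> contains_pattern (Suc n) \<sigma> [3, 1, 2]"
  obtains k \<rho> \<tau> where "k \<le> n" "\<rho> permutes {1..k}" "\<tau> permutes {1..n - k}" "\<sigma> = glue k \<rho> \<tau>"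
proof -
  have inj: "inj \<sigma>" by (rule permutes_inj[OF \<sigma>])
  define c where "c = inv \<sigma> 1"
  have c: "1 \<le> c" "c \<le> Suc n" "\<sigma> c = 1"
    using permutes_in_Icc1[OF permutes_inv[OF \<sigma>], of 1] by (auto simp: c_def permutes_inverses[OF \<sigma>])
  define k where "k = c - 1"
  have k: "c = Suc k" "k \<le> n" using c by (auto simp: k_def)
  have block: "\<sigma> ` {1..Suc k} = {1..Suc k}"
    using avoiding_312_block[OF \<sigma> av c] k by simp
  have lo: "2 \<le> \<sigma> i \<and> \<sigma> i \<le> Suc k" if "1 \<le> i" "i \<le> k" for i
  proof -
    have "\<sigma> i \<in> {1..Suc k}" using block that by auto
    moreover have "\<sigma> i \<noteq> 1" using c k that injD[OF inj, of i c] by auto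
    ultimately show ?thesis by auto
  qed
  have hi: "Suc k < \<sigma> i \<and> \<sigma> i \<le> Suc n" if "Suc k < i" "i \<le> Suc n" for i
  proof -
    have "\<sigma> i \<notin> \<sigma> ` {1..Suc k}" using that by (simp add: inj_image_mem_iff[OF inj])
    then have "\<sigma> i \<notin> {1..Suc k}" unfolding block .
    moreover have "1 \<le> \<sigma> i" "\<sigma> i \<le> Suc n" using permutes_in_Icc1[OF \<sigma>, of i] that by auto
    ultimately show ?thesis by auto
  qed
  \<comment> \<open>The truncated subtractions in \<alpha> and \<tau> lose nothing: by
    \<open>lo\<close> and \<open>hi\<close> the letters involved are at least 2 and greater than k +
    1 respectively.\<close>
  define \<alpha> where "\<alpha> i = (if i \<in> {1..k} then \<sigma> i - 1 else i)" for i
  define \<tau> where "\<tau> i = (if i \<in> {1..n - k} then \<sigma> (i + Suc k) - Suc k else i)" for i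
  have \<alpha>: "\<alpha> permutes {1..k}"
  proof (rule bij_imp_permutes)
    have "\<alpha> ` {1..k} \<subseteq> {1..k}" using lo by (fastforce simp: \<alpha>_def)
    moreover have "inj_on \<alpha> {1..k}"
    proof (rule inj_onI)
      fix i j assume "i \<in> {1..k}" "j \<in> {1..k}" "\<alpha> i = \<alpha> j"
      then have "\<sigma> i = \<sigma> j" using lo[of i] lo[of j] by (auto simp: \<alpha>_def)
      then show "i = j" by (rule injD[OF inj])
    qed
    ultimately show "bij_betw \<alpha> {1..k} {1..k}" by (simp add: bij_betw_def endo_inj_surj)
  qed (auto simp: \<alpha>_def)
  have \<tau>: "\<tau> permutes {1..n - k}"
  proof (rule bij_imp_permutes)
    have h: "Suc k < \<sigma> (i + Suc k) \<and> \<sigma> (i + Suc k) \<le> Suc n" if "i \<in> {1..n - k}" for i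
      using hi[of "i + Suc k"] that k by auto
    then have "\<tau> ` {1..n - k} \<subseteq> {1..n - k}" by (fastforce simp: \<tau>_def)
    moreover have "inj_on \<tau> {1..n - k}"
    proof (rule inj_onI)
      fix i j assume "i \<in> {1..n - k}" "j \<in> {1..n - k}" "\<tau> i = \<tau> j"
      then have "\<sigma> (i + Suc k) = \<sigma> (j + Suc k)"
        using h[of i] h[of j] by (auto simp: \<tau>_def)
      then show "i = j" using injD[OF inj, of "i + Suc k" "j + Suc k"] by simp
    qed
    ultimately show "bij_betw \<tau> {1..n - k} {1..n - k}" by (simp add: bij_betw_def endo_inj_surj)
  qed (auto simp: \<tau>_def)
  have "\<sigma> i = glue k (inv \<alpha>) \<tau> i" for i
  proof -
    consider "i = 0" | "1 \<le> i" "i \<le> k" | "i = Suc k" | "Suc k < i" "i \<le> Suc n" | "Suc n < i"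
      by linarith
    then show ?thesis
    proof cases
      case 1
      then show ?thesis using permutes_not_in[OF \<sigma>, of 0] by (simp add: glue_def)
    next
      case 2
      then show ?thesis using lo[of i] by (simp add: glue_def permutes_inv_inv[OF \<alpha>] \<alpha>_def)
    next
      case 3
      then show ?thesis using c k by (simp add: glue_def)
    next
      case 4
      then show ?thesis using hi[of i] by (auto simp: glue_def \<tau>_def)
    next
      case 5
      then show ?thesis using permutes_not_in[OF \<sigma>, of i] k by (auto simp: glue_def \<tau>_def)
    qed
  qed
  then have "\<sigma> = glue k (inv \<alpha>) \<tau>" by blast
  with that k(2) permutes_inv[OF \<alpha>] \<tau> show thesis by blast
qed

lemma bij_betw_glue:
  "bij_betw (\<lambda>(k, \<rho>, \<tau>). glue k \<rho> \<tau>)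
    (SIGMA k:{0..n}. avoiders k [2, 3, 1] \<times> avoiders (n - k) [3, 1, 2]) (avoiders (Suc n) [3, 1, 2])"
    (is "bij_betw ?g ?S ?T")
proof (rule bij_betw_imageI)
  show "inj_on ?g ?S"
  proof (rule inj_onI, clarsimp simp del: One_nat_def simp: avoiders_def perms_def, goal_cases)
    case (1 k \<rho> \<tau> k' \<rho>' \<tau>')
    then show ?case using glue_eq_imp_eq[of \<rho> k \<tau> "n - k" \<rho>' k' \<tau>' "n - k'"] by auto
  qed
  show "?g ` ?S = ?T"
  proof (intro equalityI subsetI)
    fix \<sigma> assume "\<sigma> \<in> ?g ` ?S"
    then obtain k \<rho> \<tau> where *: "k \<le> n" "\<rho> permutes {1..k}" "\<tau> permutes {1..n - k}"
      "\<not> contains_pattern k \<rho> [2, 3, 1]" "\<not> contains_pattern (n - k) \<tau> [3, 1, 2]"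
      and \<sigma>: "\<sigma> = glue k \<rho> \<tau>"
      by (auto simp: avoiders_def perms_def)
    \<comment> \<open>The facts on \<open>glue\<close> speak of size k + Suc m; for m = n - k this
      is \<open>Suc n\<close> because k \<le> n.\<close>
    have "k + Suc (n - k) = Suc n" using *(1) by simp
    with glue_permutes[OF *(2,3)] contains_312_glue_iff[OF *(2,3)] *(4,5)
    show "\<sigma> \<in> ?T" unfolding \<sigma> avoiders_def perms_def by simp
  next
    fix \<sigma> assume "\<sigma> \<in> ?T"
    then have p: "\<sigma> permutes {1..Suc n}" and av: "\<not> contains_pattern (Suc n) \<sigma> [3, 1, 2]"
      by (auto simp: avoiders_def perms_def)
    from avoiding_312_eq_glue[OF p av] obtain k \<rho> \<tau> where
      *: "k \<le> n" "\<rho> permutes {1..k}" "\<tau> permutes {1..n - k}" and \<sigma>: "\<sigma> = glue k \<rho> \<tau>" by blast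
    have "k + Suc (n - k) = Suc n" using *(1) by simp
    with contains_312_glue_iff[OF *(2,3)] av
    have "\<not> contains_pattern k \<rho> [2, 3, 1]" "\<not> contains_pattern (n - k) \<tau> [3, 1, 2]"
      unfolding \<sigma> by auto
    with * have "(k, \<rho>, \<tau>) \<in> ?S" by (auto simp: avoiders_def perms_def)
    then show "\<sigma> \<in> ?g ` ?S" unfolding \<sigma> by force
  qed
qed

section \<open>From the bijection to the generating functions\<close>

lemma finite_avoiders: "finite (avoiders n p)"
  unfolding avoiders_def perms_def by (simp add: finite_permutations)

text \<open>Additivity of crossings makes the weight multiplicative along
  \<open>bij_betw_glue\<close>, so for each k the sum factors into a product, and the total is a
  Cauchy convolution.\<close>

lemma crossing_poly_312_Suc:
  "crossing_poly [3, 1, 2] (Suc n) =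
    (\<Sum>k=0..n. crossing_poly [2, 3, 1] k * crossing_poly [3, 1, 2] (n - k))"
proof -
  let ?q = "[:0, 1:] :: int poly"
  let ?S = "SIGMA k:{0..n}. avoiders k [2, 3, 1] \<times> avoiders (n - k) [3, 1, 2]"
  have "crossing_poly [3, 1, 2] (Suc n) = (\<Sum>(k, \<rho>, \<tau>)\<in>?S. ?q ^ cr (Suc n) (glue k \<rho> \<tau>))"
    unfolding crossing_poly_def sum.reindex_bij_betw[OF bij_betw_glue, symmetric]
    by (simp add: case_prod_unfold)
  also have "\<dots> = (\<Sum>(k, \<rho>, \<tau>)\<in>?S. ?q ^ cr k \<rho> * ?q ^ cr (n - k) \<tau>)"
  proof (rule sum.cong[OF refl], clarify)
    fix k \<rho> \<tau> assume "k \<in> {0..n}" "\<rho> \<in> avoiders k [2, 3, 1]" "\<tau> \<in> avoiders (n - k) [3, 1, 2]"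
    then have "cr (Suc n) (glue k \<rho> \<tau>) = cr k \<rho> + cr (n - k) \<tau>"
      using cr_glue[of \<rho> k \<tau> "n - k"] by (simp add: avoiders_def perms_def)
    then show "?q ^ cr (Suc n) (glue k \<rho> \<tau>) = ?q ^ cr k \<rho> * ?q ^ cr (n - k) \<tau>"
      by (simp only: power_add)
  qed
  also have "\<dots> = (\<Sum>k=0..n. \<Sum>(\<rho>, \<tau>)\<in>avoiders k [2, 3, 1] \<times> avoiders (n - k) [3, 1, 2].
      ?q ^ cr k \<rho> * ?q ^ cr (n - k) \<tau>)"
    by (subst sum.Sigma) (auto simp: finite_avoiders)
  also have "\<dots> = (\<Sum>k=0..n. crossing_poly [2, 3, 1] k * crossing_poly [3, 1, 2] (n - k))"
    by (simp only: crossing_poly_def sum_product sum.cartesian_product)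
  finally show ?thesis .
qed

lemma crossing_poly_312_0: "crossing_poly [3, 1, 2] 0 = 1"
proof -
  have "\<not> contains_pattern 0 id [3, 1, 2]" unfolding contains_312_iff by auto
  then have "avoiders 0 [3, 1, 2] = {id}" by (auto simp: avoiders_def perms_def)
  then show ?thesis by (simp add: crossing_poly_def cr_def crossings_def)
qed

theorem mainTheorem3:
  shows "F [3, 1, 2] = 1 / (1 - fps_X * F [2, 3, 1])"
proof -
  have F_0: "fps_nth (F [3, 1, 2]) 0 = 1"
    unfolding F_def by (simp only: fps_nth_Abs_fps crossing_poly_312_0 to_fract_1)
  \<comment> \<open>The embedding \<open>to_fract\<close> respects sums and products, so the
    convolution carries over to the fraction field.\<close>
  have F_Suc: "fps_nth (F [3, 1, 2]) (Suc n) = fps_nth (F [2, 3, 1] * F [3, 1, 2]) n" for n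
    unfolding F_def fps_mult_nth
    by (simp only: fps_nth_Abs_fps crossing_poly_312_Suc to_fract_sum to_fract_mult)
  have "F [3, 1, 2] = 1 + fps_X * (F [2, 3, 1] * F [3, 1, 2])"
  proof (rule fps_ext)
    fix n
    show "fps_nth (F [3, 1, 2]) n = fps_nth (1 + fps_X * (F [2, 3, 1] * F [3, 1, 2])) n"
      by (cases n) (simp_all add: F_0 F_Suc del: One_nat_def)
  qed
  then have "F [3, 1, 2] * (1 - fps_X * F [2, 3, 1]) = 1"
    by (simp add: algebra_simps)
  \<comment> \<open>A product equal to 1 has nonzero factors, so the denominator can be
    cancelled.\<close>
  then show ?thesis
    by (metis nonzero_mult_div_cancel_right mult_zero_right zero_neq_one)
qed

end
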